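(* Let $D$ be a convex set of a real linear space $X$. Let $\mathscr{A}$ be a sigma algebra containing the Borel subsets of $[0,1]$ and let $\mu$ be a probability measure on $([0,1],\mathscr{A})$. Denote $\mu_1:=\int_{[0,1]}t\,d\mu(t)$. Assume that $f:D\to\mathbb{R}$ is a hemi-$\mu$-integrable solution of the approximate convexity inequality $$f((1-t)x+ty)\le(1-t)f(x)+tf(y)+\eta_{x,y}(t)\qquad((x,y)\in D^{2*},\ t\in[0,1]),$$ where, for all $(x,y)\in D^{2*}$, $\eta_{x,y}:[0,1]\to\mathbb{R}$ is a bounded and Borel measurable function. Then, for all $(x,y)\in D^{2*}$, the function $f$ also satisfies the approximate upper Hermite--Hadamard inequality $$\int_{[0,1]}f((1-t)x+ty)\,d\mu(t)\le(1-\mu_1)f(x)+\mu_1f(y)+\int_{[0,1]}\eta_{x,y}(t)\,d\mu(t).$$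
   Context: $D^{2*}:=\{(x,y)\mid x,y\in D,\ x\ne y\}$. A function $f:D\to\mathbb{R}$ is hemi-$\mu$-integrable if, for all $x,y\in D$, the mapping $t\mapsto f((1-t)x+ty)$ $(t\in[0,1])$ is $\mu$-integrable. *)

theory Defs
  imports "HOL-Probability.Probability_Measure"
begin

definition off_diagonal :: "'a set \<Rightarrow> ('a \<times> 'a) set" where
  "off_diagonal D = {(x, y). x \<in> D \<and> y \<in> D \<and> x \<noteq> y}"

(* A function on D is modelled by a total function whose values outside D are irrelevant;
   mu is meant to be a measure with space {0..1}, and for convex D only values of f on D
   enter below. *)
definition hemi_integrable ::
    "real measure \<Rightarrow> 'a::real_vector set \<Rightarrow> ('a \<Rightarrow> real) \<Rightarrow> bool" where
  "hemi_integrable \<mu> D f \<longleftrightarrow>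
     (\<forall>x\<in>D. \<forall>y\<in>D. integrable \<mu> (\<lambda>t. f ((1 - t) *\<^sub>R x + t *\<^sub>R y)))"

definition first_moment :: "real measure \<Rightarrow> real" where
  "first_moment \<mu> = (\<integral>t. t \<partial>\<mu>)"

end

theory Submission
  imports Defs
begin

text \<open>For fixed x and y, integrate the pointwise inequality in t against \<open>\<mu>\<close>.
  The right-hand side is affine in t plus the error term, so by linearity its integral depends on
  \<open>\<mu>\<close> only through the total mass 1, the first moment and the integral of
  \<open>\<eta> x y\<close>. What needs care is integrability: the left-hand side is integrable by
  hemi-integrability, while t and \<open>\<eta> x y\<close> are bounded and Borel on [0,1], which
  \<open>integrable_of_borel_subalgebra\<close> turns into integrability over the possibly finer
  sigma algebra of \<open>\<mu>\<close>.\<close>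

lemma (in prob_space) integrable_of_borel_subalgebra:
  fixes g :: "'a \<Rightarrow> real"
  assumes "space N = space M" "sets N \<subseteq> sets M"
    and "g \<in> borel_measurable N" "bounded (g ` space M)"
  shows "integrable M g"
proof -
  \<comment> \<open>Since the two spaces agree, preimages under \<open>g\<close> are the same sets
    for \<open>N\<close> and \<open>M\<close>; they lie in \<open>sets N\<close>, hence in
    \<open>sets M\<close>.\<close>
  have "g \<in> borel_measurable M"
    using assms(1-3) by (auto simp: measurable_def)
  moreover obtain B where "\<And>t. t \<in> space M \<Longrightarrow> norm (g t) \<le> B"
    using assms(4) by (auto simp: bounded_iff)
  ultimately show ?thesis
    by (intro integrable_const_bound[where B = B] AE_I2)
qed

theorem theorem14:
  fixes D :: "'a::real_vector set"
    and \<mu> :: "real measure"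
    and f :: "'a \<Rightarrow> real"
    and \<eta> :: "'a \<Rightarrow> 'a \<Rightarrow> real \<Rightarrow> real"
  assumes "convex D"
    and "prob_space \<mu>"
    and "space \<mu> = {0..1}"
    and "sets (restrict_space borel {0..1}) \<subseteq> sets \<mu>"
    and "hemi_integrable \<mu> D f"
    and "\<forall>(x, y)\<in>off_diagonal D. bounded (\<eta> x y ` {0..1}) \<and>
           \<eta> x y \<in> borel_measurable (restrict_space borel {0..1})"
    and "\<forall>(x, y)\<in>off_diagonal D. \<forall>t\<in>{0..1}.
           f ((1 - t) *\<^sub>R x + t *\<^sub>R y) \<le> (1 - t) * f x + t * f y + \<eta> x y t"
  shows "\<forall>(x, y)\<in>off_diagonal D.
           (\<integral>t. f ((1 - t) *\<^sub>R x + t *\<^sub>R y) \<partial>\<mu>) \<le>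
             (1 - first_moment \<mu>) * f x + first_moment \<mu> * f y + (\<integral>t. \<eta> x y t \<partial>\<mu>)"
proof (intro ballI, clarify)
  fix x y assume xy: "(x, y) \<in> off_diagonal D"
  interpret prob_space \<mu> by fact
  let ?B = "restrict_space borel {0..1::real}"
  have space_B: "space ?B = space \<mu>"
    using assms(3) by (simp add: space_restrict_space)
  have int_t: "integrable \<mu> (\<lambda>t. t)"
    by (rule integrable_of_borel_subalgebra[OF space_B assms(4)])
       (auto simp: assms(3) intro: measurable_restrict_space1)
  have int_\<eta>: "integrable \<mu> (\<eta> x y)"
    using xy assms(6) by (intro integrable_of_borel_subalgebra[OF space_B assms(4)])
       (auto simp: assms(3))
  have int_f: "integrable \<mu> (\<lambda>t. f ((1 - t) *\<^sub>R x + t *\<^sub>R y))"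
    using xy assms(5) by (auto simp: hemi_integrable_def off_diagonal_def)
  \<comment> \<open>Monotonicity asks for the inequality only on \<open>space \<mu>\<close>, which
    is exactly [0,1], where the hypothesis provides it.\<close>
  have "(\<integral>t. f ((1 - t) *\<^sub>R x + t *\<^sub>R y) \<partial>\<mu>)
      \<le> (\<integral>t. (1 - t) * f x + t * f y + \<eta> x y t \<partial>\<mu>)"
    using xy assms(3,7) int_f int_t int_\<eta> by (intro integral_mono) auto
  \<comment> \<open>\<open>prob_space\<close> gives the constant 1 integral 1, so 1 - t integrates
    to 1 minus the first moment.\<close>
  also have "\<dots> = (1 - first_moment \<mu>) * f x + first_moment \<mu> * f y + (\<integral>t. \<eta> x y t \<partial>\<mu>)"
    using int_t int_\<eta> by (simp add: first_moment_def prob_space)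
  finally show "(\<integral>t. f ((1 - t) *\<^sub>R x + t *\<^sub>R y) \<partial>\<mu>)
      \<le> (1 - first_moment \<mu>) * f x + first_moment \<mu> * f y + (\<integral>t. \<eta> x y t \<partial>\<mu>)" .
qed

end
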